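(* Let $U$ be a non-empty finite set of positive integers, let $p=(p_1,p_2)$ with $p_1,p_2$ positive integers and $p_1+p_2=|U|$, and let $p'=(p_2,p_1)$. Let $H$ be any finite graph (loops and parallel edges allowed) with $U\subseteq V(H)$. Then $$\sum_{\substack{Q\in \mathcal{CT}_{U,p}\\ H\cup Q \text{ connected}}} T_{H\cup Q}(1,y)=\sum_{\substack{Q\in \mathcal{CT}_{U,p'}\\ H\cup Q \text{ connected}}} T_{H\cup Q}(1,y).$$
   Context: A tiered graph with two tiers is a simple graph $Q$ whose vertex set is a finite set of positive integers, together with a map $t:V(Q)\to\{1,2\}$ such that whenever $vv'\in E(Q)$ with $v>v'$ we have $t(v)>t(v')$; write $V_i(Q)=t^{-1}(i)$. Two tiered graphs are regarded as different if their edge sets differ or $V_i$ differs for some $i$. For an ordered pair $p=(p_1,p_2)$ of positive integers with $p_1+p_2=|U|$, $\mathcal{CT}_{U,p}$ denotes the set of complete tiered graphs $Q$ with $V(Q)=U$, $|V_1(Q)|=p_1$, $|V_2(Q)|=p_2$, where "complete" means: for $u\in V_1(Q)$, $v\in V_2(Q)$, $uv\in E(Q)$ if and only if $u<v$ (and there are no other edges). Thus $\mathcal{CT}_{U,p}$ has exactly $\binom{|U|}{p_1}$ elements, one for each choice of $V_1(Q)$. For a graph $H$ with $U\subseteq V(H)$, $H\cup Q$ denotes the graph with vertex set $V(H)$ and edge set the disjoint union $E(H)\uplus E(Q)$ (an edge of $H$ and an edge of $Q$ are always distinct edges, even if they have the same endpoints). $T_G(x,y)$ denotes the Tutte polynomial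 of the graph $G$ (defined by $T_G=1$ if $E(G)=\emptyset$, $T_G=yT_{G\setminus e}$ for a loop $e$, $T_G=xT_{G/e}$ for a bridge $e$, and $T_G=T_{G\setminus e}+T_{G/e}$ otherwise). *)

theory Defs
  imports
    "HOL-Library.Uprod"
    "HOL-Library.FuncSet"
    "HOL-Computational_Algebra.Polynomial"
begin

section \<open>Finite graphs with loops and parallel edges\<close>

text \<open>An edge has an unordered pair of ends; \<open>Upair v v\<close> is a loop at \<open>v\<close>.\<close>

record ('v, 'e) mgraph =
  verts :: "'v set"
  edges :: "'e set"
  ends :: "'e \<Rightarrow> 'v uprod"

definition finite_graph :: "('v, 'e) mgraph \<Rightarrow> bool" where
  "finite_graph G \<longleftrightarrow> finite (verts G) \<and> finite (edges G) \<and>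
     (\<forall>e\<in>edges G. set_uprod (ends G e) \<subseteq> verts G)"

definition reach :: "('v, 'e) mgraph \<Rightarrow> ('v \<times> 'v) set" where
  "reach G = {(u, v). \<exists>e\<in>edges G. ends G e = Upair u v}\<^sup>*"

definition connected_graph :: "('v, 'e) mgraph \<Rightarrow> bool" where
  "connected_graph G \<longleftrightarrow> verts G \<noteq> {} \<and> (\<forall>u\<in>verts G. \<forall>v\<in>verts G. (u, v) \<in> reach G)"

definition delete :: "('v, 'e) mgraph \<Rightarrow> 'e \<Rightarrow> ('v, 'e) mgraph" where
  "delete G e = G\<lparr>edges := edges G - {e}\<rparr>"

text \<open>Contraction of an edge \<open>e\<close> with ends \<open>u\<close> and \<open>v\<close>; the merged vertex is named \<open>u\<close>.
  Other edges joining \<open>u\<close> and \<open>v\<close> become loops.\<close>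

definition merge :: "'v \<Rightarrow> 'v \<Rightarrow> 'v \<Rightarrow> 'v" where
  "merge u v w = (if w = v then u else w)"

definition contract :: "('v, 'e) mgraph \<Rightarrow> 'e \<Rightarrow> 'v \<Rightarrow> 'v \<Rightarrow> ('v, 'e) mgraph" where
  "contract G e u v =
     \<lparr>verts = merge u v ` verts G, edges = edges G - {e}, ends = map_uprod (merge u v) \<circ> ends G\<rparr>"

definition is_loop :: "('v, 'e) mgraph \<Rightarrow> 'e \<Rightarrow> bool" where
  "is_loop G e \<longleftrightarrow> e \<in> edges G \<and> (\<exists>v. ends G e = Upair v v)"

definition is_bridge :: "('v, 'e) mgraph \<Rightarrow> 'e \<Rightarrow> bool" where
  "is_bridge G e \<longleftrightarrow> e \<in> edges G \<and>
     (\<exists>u v. ends G e = Upair u v \<and> (u, v) \<notin> reach (delete G e))"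


section \<open>The Tutte polynomial\<close>

text \<open>Polynomials in \<open>x\<close> and \<open>y\<close> are polynomials in \<open>x\<close> whose coefficients are polynomials
  in \<open>y\<close>; hence \<open>T(1, y)\<close> is \<open>poly T 1\<close>, a value of type \<open>int poly\<close>.\<close>

abbreviation var_x :: "int poly poly" where
  "var_x \<equiv> [:0, 1:]"

abbreviation var_y :: "int poly poly" where
  "var_y \<equiv> [:[:0, 1:]:]"

text \<open>\<open>tutte_rel G P\<close>: some run of the deletion-contraction recursion on \<open>G\<close> yields \<open>P\<close>.
  The edge treated at each step is arbitrary, as is the name given to a merged vertex. That the
  result does not depend on these choices is proved in \<open>tutte_rel_ex1\<close> below.\<close>

inductive tutte_rel :: "('v, 'e) mgraph \<Rightarrow> int poly poly \<Rightarrow> bool" where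
  empty: "edges G = {} \<Longrightarrow> tutte_rel G 1"
| loop: "is_loop G e \<Longrightarrow> tutte_rel (delete G e) P \<Longrightarrow> tutte_rel G (var_y * P)"
| bridge: "is_bridge G e \<Longrightarrow> ends G e = Upair u v \<Longrightarrow> tutte_rel (contract G e u v) P
    \<Longrightarrow> tutte_rel G (var_x * P)"
| ordinary: "e \<in> edges G \<Longrightarrow> \<not> is_loop G e \<Longrightarrow> \<not> is_bridge G e \<Longrightarrow> ends G e = Upair u v
    \<Longrightarrow> tutte_rel (delete G e) P \<Longrightarrow> tutte_rel (contract G e u v) P'
    \<Longrightarrow> tutte_rel G (P + P')"

definition tutte :: "('v, 'e) mgraph \<Rightarrow> int poly poly" where
  "tutte G = (THE P. tutte_rel G P)"


subsection \<open>Well-definedness\<close>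

text \<open>Every value of the recursion equals the rank-generating polynomial
  \<open>\<Sum>A\<subseteq>E. (x - 1)^(k A - k E) (y - 1)^(k A + |A| - |V|)\<close>, where \<open>k A\<close> is the number of components
  of the spanning subgraph with edge set \<open>A\<close>.\<close>

definition reach_by :: "('v, 'e) mgraph \<Rightarrow> 'e set \<Rightarrow> ('v \<times> 'v) set" where
  "reach_by G A = {(u, v). \<exists>e\<in>A. ends G e = Upair u v}\<^sup>*"

definition num_comps :: "('v, 'e) mgraph \<Rightarrow> 'e set \<Rightarrow> nat" where
  "num_comps G A = card ((\<lambda>v. reach_by G A `` {v}) ` verts G)"

definition rank_poly :: "'r::comm_ring_1 \<Rightarrow> 'r \<Rightarrow> ('v, 'e) mgraph \<Rightarrow> 'r" where
  "rank_poly x y G = (\<Sum>A\<in>Pow (edges G). (x - 1) ^ (num_comps G A - num_comps G (edges G)) *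
     (y - 1) ^ (num_comps G A + card A - card (verts G)))"

lemma reach_by_refl [simp]: "(u, u) \<in> reach_by G A"
  by (simp add: reach_by_def)

lemma reach_by_trans: "(u, v) \<in> reach_by G A \<Longrightarrow> (v, w) \<in> reach_by G A \<Longrightarrow> (u, w) \<in> reach_by G A"
  unfolding reach_by_def by (rule rtrancl_trans)

lemma reach_by_sym: "(u, v) \<in> reach_by G A \<Longrightarrow> (v, u) \<in> reach_by G A"
proof -
  have "sym {(u, v). \<exists>e\<in>A. ends G e = Upair u v}"
  proof (rule symI)
    fix a b assume "(a, b) \<in> {(u, v). \<exists>e\<in>A. ends G e = Upair u v}"
    then obtain e where "e \<in> A" "ends G e = Upair a b" by blast
    moreover from this have "ends G e = Upair b a" by simp
    ultimately show "(b, a) \<in> {(u, v). \<exists>e\<in>A. ends G e = Upair u v}" by blast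
  qed
  then have "sym (reach_by G A)"
    unfolding reach_by_def by (rule sym_rtrancl)
  then show "(u, v) \<in> reach_by G A \<Longrightarrow> (v, u) \<in> reach_by G A"
    by (rule symD)
qed

lemma reach_by_edge: "e \<in> A \<Longrightarrow> ends G e = Upair u v \<Longrightarrow> (u, v) \<in> reach_by G A"
  unfolding reach_by_def by blast

lemma reach_by_mono: "A \<subseteq> B \<Longrightarrow> reach_by G A \<subseteq> reach_by G B"
  unfolding reach_by_def by (rule rtrancl_mono) auto

lemma reach_by_delete [simp]: "reach_by (delete G e) A = reach_by G A"
  by (simp add: reach_by_def delete_def)

lemma reach_eq_reach_by: "reach (delete G e) = reach_by G (edges G - {e})"
  by (simp add: reach_def reach_by_def delete_def)

lemma reach_class_eq_iff: "reach_by G A `` {u} = reach_by G A `` {v} \<longleftrightarrow> (u, v) \<in> reach_by G A"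
  by (auto intro: reach_by_trans reach_by_sym)

lemma reach_by_insert:
  assumes "ends G e = Upair u v"
  shows "(a, b) \<in> reach_by G (insert e A) \<longleftrightarrow> (a, b) \<in> reach_by G A \<or>
    (a, u) \<in> reach_by G A \<and> (v, b) \<in> reach_by G A \<or>
    (a, v) \<in> reach_by G A \<and> (u, b) \<in> reach_by G A" (is "?L \<longleftrightarrow> ?R b")
proof
  assume ?L
  then show "?R b"
    unfolding reach_by_def[of G "insert e A"]
  proof (induction rule: rtrancl_induct)
    case base
    then show ?case by simp
  next
    case (step y z)
    then obtain f where f: "f \<in> insert e A" "ends G f = Upair y z" by auto
    show ?case
    proof (cases "f \<in> A")
      case True
      then have "(y, z) \<in> reach_by G A" using f(2) by (rule reach_by_edge)
      then show ?thesis using step.IH by (meson reach_by_trans)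
    next
      case False
      then have "y = u \<and> z = v \<or> y = v \<and> z = u" using f assms by auto
      then show ?thesis using step.IH by auto
    qed
  qed
next
  have m: "(p, q) \<in> reach_by G A \<Longrightarrow> (p, q) \<in> reach_by G (insert e A)" for p q
    using reach_by_mono[of A "insert e A" G] by auto
  have "(u, v) \<in> reach_by G (insert e A)" using assms by (auto intro: reach_by_edge)
  moreover assume "?R b"
  ultimately show ?L by (meson m reach_by_trans reach_by_sym)
qed

lemma card_image_eq_if_same_kernel:
  assumes "\<And>a b. a \<in> V \<Longrightarrow> b \<in> V \<Longrightarrow> f a = f b \<longleftrightarrow> g a = g b"
  shows "card (f ` V) = card (g ` V)"
proof -
  have "bij_betw (\<lambda>c. g (inv_into V f c)) (f ` V) (g ` V)"
  proof (rule bij_betw_imageI)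
    show "inj_on (\<lambda>c. g (inv_into V f c)) (f ` V)"
      by (rule inj_onI) (metis assms f_inv_into_f inv_into_into)
    have "g (inv_into V f (f a)) = g a" if "a \<in> V" for a
      using that by (metis assms f_inv_into_f imageI inv_into_into)
    then show "(\<lambda>c. g (inv_into V f c)) ` f ` V = g ` V"
      by (force simp: image_image)
  qed
  then show ?thesis by (rule bij_betw_same_card)
qed

lemma num_comps_insert_same:
  assumes "ends G e = Upair u v" "(u, v) \<in> reach_by G A"
  shows "num_comps G (insert e A) = num_comps G A"
proof -
  have "reach_by G (insert e A) = reach_by G A"
    unfolding set_eq_iff split_paired_All reach_by_insert[OF assms(1)]
    by (meson assms(2) reach_by_trans reach_by_sym)
  then show ?thesis by (simp add: num_comps_def)
qed

lemma num_comps_insert_less: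
  assumes "finite (verts G)" "u \<in> verts G" "v \<in> verts G"
    and "ends G e = Upair u v" "(u, v) \<notin> reach_by G A"
  shows "num_comps G A = Suc (num_comps G (insert e A))"
proof -
  define f where "f a = reach_by G A `` {a}" for a
  define g where "g a = (if f a = f v then f u else f a)" for a
  have ff: "f a = f b \<longleftrightarrow> (a, b) \<in> reach_by G A" for a b
    unfolding f_def by (rule reach_class_eq_iff)
  have fuv: "f u \<noteq> f v" using assms(5) ff by blast
  have "(a, b) \<in> reach_by G (insert e A) \<longleftrightarrow> g a = g b" for a b
    unfolding reach_by_insert[OF assms(4)] ff[symmetric] g_def using fuv by auto
  then have "num_comps G (insert e A) = card (g ` verts G)"
    unfolding num_comps_def
    by (intro card_image_eq_if_same_kernel) (simp add: reach_class_eq_iff)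
  also have "g ` verts G = f ` verts G - {f v}"
    using assms(2) fuv by (auto simp: g_def image_iff)
  also have "card \<dots> = num_comps G A - 1"
    using assms(1,3) by (simp add: num_comps_def f_def)
  finally show ?thesis
    using assms(1,3) by (metis (no_types, lifting) One_nat_def Suc_pred card_gt_0_iff empty_iff
      finite_imageI imageI num_comps_def)
qed

lemma finite_graph_ends:
  "finite_graph G \<Longrightarrow> e \<in> edges G \<Longrightarrow> ends G e = Upair u v \<Longrightarrow> u \<in> verts G \<and> v \<in> verts G"
  unfolding finite_graph_def by force

lemma num_comps_bounds:
  assumes "finite_graph G" "A \<subseteq> edges G" "e \<in> edges G"
  shows "num_comps G (insert e A) \<le> num_comps G A \<and>
    num_comps G A \<le> Suc (num_comps G (insert e A))"
proof -
  obtain u v where uv: "ends G e = Upair u v" by (cases "ends G e") auto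
  show ?thesis
  proof (cases "(u, v) \<in> reach_by G A")
    case True
    then show ?thesis using num_comps_insert_same[OF uv True] by linarith
  next
    case False
    have "finite (verts G)" "u \<in> verts G" "v \<in> verts G"
      using finite_graph_ends[OF assms(1,3) uv] assms(1) by (auto simp: finite_graph_def)
    then have "num_comps G A = Suc (num_comps G (insert e A))"
      using uv False by (rule num_comps_insert_less)
    then show ?thesis by linarith
  qed
qed

lemma num_comps_empty: "num_comps G {} = card (verts G)"
proof -
  have "inj_on (\<lambda>v. reach_by G {} `` {v}) (verts G)"
    by (simp add: inj_on_def reach_by_def)
  then show ?thesis by (simp add: num_comps_def card_image)
qed

lemma card_verts_le:
  assumes "finite_graph G" "A \<subseteq> edges G"
  shows "card (verts G) \<le> num_comps G A + card A"
proof -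
  have "finite A" using assms finite_subset by (auto simp: finite_graph_def)
  then show ?thesis using assms(2)
  proof (induction A rule: finite_induct)
    case empty
    then show ?case by (simp add: num_comps_empty)
  next
    case (insert e A)
    then show ?case using num_comps_bounds[OF assms(1), of A e] by simp
  qed
qed

lemma num_comps_antimono:
  assumes "finite_graph G" "A \<subseteq> B" "B \<subseteq> edges G"
  shows "num_comps G B \<le> num_comps G A"
proof -
  have "num_comps G (A \<union> D) \<le> num_comps G A" if "finite D" "D \<subseteq> edges G" for D
    using that
  proof (induction D rule: finite_induct)
    case (insert e D)
    then show ?case using num_comps_bounds[OF assms(1), of "A \<union> D" e] subset_trans[OF assms(2,3)] by auto
  qed simp
  moreover have "finite B" using assms finite_subset by (auto simp: finite_graph_def)
  then have "finite (B - A)" by simp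
  moreover have "A \<union> (B - A) = B" using assms(2) by auto
  ultimately show ?thesis using assms(3) by (metis Diff_subset order_trans)
qed

lemma reach_by_contract:
  assumes e: "ends G e = Upair u v" and "e \<notin> A"
  shows "(merge u v a, merge u v b) \<in> reach_by (contract G e u v) A \<longleftrightarrow>
    (a, b) \<in> reach_by G (insert e A)"
proof
  let ?R = "reach_by G (insert e A)"
  have uv: "(u, v) \<in> ?R" using e by (auto intro: reach_by_edge)
  have m: "(a, merge u v a) \<in> ?R" for a
    using uv by (auto simp: merge_def intro: reach_by_sym)
  have "(p, q) \<in> reach_by (contract G e u v) A \<Longrightarrow> (p, q) \<in> ?R" for p q
    unfolding reach_by_def[of "contract G e u v"]
  proof (induction rule: rtrancl_induct)
    case base
    then show ?case by simp
  next
    case (step y z)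
    then obtain f where f: "f \<in> A" "map_uprod (merge u v) (ends G f) = Upair y z"
      by (auto simp: contract_def)
    obtain c d where cd: "ends G f = Upair c d" by (cases "ends G f") auto
    have "(c, d) \<in> ?R" using f cd by (auto intro: reach_by_edge)
    then have "(merge u v c, merge u v d) \<in> ?R" by (meson m reach_by_sym reach_by_trans)
    then have "(y, z) \<in> ?R" using f(2) cd by (auto intro: reach_by_sym)
    with step.IH show ?case by (rule reach_by_trans)
  qed
  then show "(merge u v a, merge u v b) \<in> reach_by (contract G e u v) A \<Longrightarrow> (a, b) \<in> ?R"
    by (meson m reach_by_sym reach_by_trans)
next
  assume "(a, b) \<in> reach_by G (insert e A)"
  then show "(merge u v a, merge u v b) \<in> reach_by (contract G e u v) A"
    unfolding reach_by_def[of G]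
  proof (induction rule: rtrancl_induct)
    case base
    then show ?case by simp
  next
    case (step y z)
    then obtain f where f: "f \<in> insert e A" "ends G f = Upair y z" by auto
    have "(merge u v y, merge u v z) \<in> reach_by (contract G e u v) A"
    proof (cases "f = e")
      case True
      then have "merge u v y = merge u v z" using f e by (auto simp: merge_def)
      then show ?thesis by simp
    next
      case False
      then show ?thesis using f by (intro reach_by_edge[of f]) (auto simp: contract_def)
    qed
    with step.IH show ?case by (rule reach_by_trans)
  qed
qed

lemma num_comps_contract:
  assumes "ends G e = Upair u v" "e \<notin> A"
  shows "num_comps (contract G e u v) A = num_comps G (insert e A)"
proof -
  have "num_comps (contract G e u v) A =
      card ((\<lambda>a. reach_by (contract G e u v) A `` {merge u v a}) ` verts G)"
    by (simp add: num_comps_def contract_def image_image)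
  also have "\<dots> = num_comps G (insert e A)"
    unfolding num_comps_def
    by (intro card_image_eq_if_same_kernel) (simp add: reach_class_eq_iff reach_by_contract[OF assms])
  finally show ?thesis .
qed

lemma num_comps_delete [simp]: "num_comps (delete G e) A = num_comps G A"
  by (simp add: num_comps_def) (simp add: delete_def)

lemma finite_graph_delete: "finite_graph G \<Longrightarrow> finite_graph (delete G e)"
  by (auto simp: finite_graph_def delete_def)

lemma finite_graph_contract: "finite_graph G \<Longrightarrow> finite_graph (contract G e u v)"
proof -
  have "set_uprod (map_uprod h p) = h ` set_uprod p" for h :: "'a \<Rightarrow> 'a" and p
    by (cases p) auto
  then show "finite_graph G \<Longrightarrow> finite_graph (contract G e u v)"
    by (auto simp: finite_graph_def contract_def intro!: imageI)
qed

lemma card_verts_contract: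
  assumes "finite_graph G" "u \<in> verts G" "v \<in> verts G" "u \<noteq> v"
  shows "card (verts G) = Suc (card (verts (contract G e u v)))"
proof -
  have "verts (contract G e u v) = verts G - {v}"
    using assms by (auto simp: contract_def merge_def)
  then show ?thesis
    using assms by (metis card.remove finite_graph_def)
qed

lemma sum_Pow_insert_split:
  assumes "finite B" "e \<notin> B"
  shows "sum h (Pow (insert e B)) = (\<Sum>A\<in>Pow B. h A + h (insert e A))"
proof -
  have "inj_on (insert e) (Pow B)" using assms(2) by (auto simp: inj_on_def)
  moreover have "Pow B \<inter> insert e ` Pow B = {}" using assms(2) by auto
  ultimately show ?thesis
    using assms by (simp add: Pow_insert sum.union_disjoint sum.reindex sum.distrib)
qed

lemma rank_poly_split:
  assumes "finite_graph G" "e \<in> edges G"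
  shows "rank_poly x y G = (\<Sum>A\<in>Pow (edges G - {e}).
      (x - 1) ^ (num_comps G A - num_comps G (edges G)) *
        (y - 1) ^ (num_comps G A + card A - card (verts G)) +
      (x - 1) ^ (num_comps G (insert e A) - num_comps G (edges G)) *
        (y - 1) ^ (num_comps G (insert e A) + Suc (card A) - card (verts G)))"
proof -
  define B where "B = edges G - {e}"
  have B: "edges G = insert e B" "finite B" "e \<notin> B"
    using assms by (auto simp: B_def finite_graph_def)
  have "card (insert e A) = Suc (card A)" if "A \<in> Pow B" for A
    using that B finite_subset by (metis PowD card_insert_disjoint subsetD)
  then show ?thesis
    unfolding rank_poly_def B_def[symmetric] unfolding B(1) sum_Pow_insert_split[OF B(2,3)]
    by (intro sum.cong) auto
qed

lemma rank_poly_loop: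
  assumes G: "finite_graph G" and "is_loop G e"
  shows "rank_poly x y G = y * rank_poly x y (delete G e)"
proof -
  obtain v where e: "e \<in> edges G" "ends G e = Upair v v" using assms(2) by (auto simp: is_loop_def)
  have same: "num_comps G (insert e A) = num_comps G A" for A
    using num_comps_insert_same[OF e(2)] by simp
  have E: "num_comps G (edges G - {e}) = num_comps G (edges G)"
    using same[of "edges G - {e}"] e(1) by (simp add: insert_absorb)
  have "num_comps G A + Suc (card A) - card (verts G)
      = Suc (num_comps G A + card A - card (verts G))" if "A \<in> Pow (edges G - {e})" for A
    using card_verts_le[OF G, of A] that by (simp add: subset_Diff_insert Suc_diff_le)
  moreover have "edges (delete G e) = edges G - {e}" "verts (delete G e) = verts G"
    by (simp_all add: delete_def)
  ultimately show ?thesis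
    unfolding rank_poly_split[OF G e(1)] rank_poly_def[of x y "delete G e"] sum_distrib_left
    by (intro sum.cong) (simp_all add: E same, simp_all add: algebra_simps)
qed

lemma rank_poly_bridge:
  assumes G: "finite_graph G" and b: "is_bridge G e" and e: "ends G e = Upair u v"
  shows "rank_poly x y G = x * rank_poly x y (contract G e u v)"
proof -
  let ?E = "edges G - {e}" and ?C = "contract G e u v"
  have eE: "e \<in> edges G" and nr: "(u, v) \<notin> reach_by G ?E"
    using b e reach_by_sym[of u v G ?E]
    by (auto simp: is_bridge_def reach_eq_reach_by)
  have uv: "u \<in> verts G" "v \<in> verts G" using finite_graph_ends[OF G eE e] by auto
  have "u \<noteq> v" using nr by auto
  have V: "card (verts G) = Suc (card (verts ?C))"
    using card_verts_contract[OF G uv \<open>u \<noteq> v\<close>] .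
  have C: "num_comps ?C A = num_comps G (insert e A)" if "A \<in> Pow ?E" for A
    using that by (intro num_comps_contract[OF e]) auto
  have less: "num_comps G A = Suc (num_comps G (insert e A))" if "A \<in> Pow ?E" for A
  proof (rule num_comps_insert_less[OF _ uv e])
    show "(u, v) \<notin> reach_by G A" using nr reach_by_mono[of A ?E G] that by auto
  qed (use G in \<open>simp add: finite_graph_def\<close>)
  have E: "num_comps ?C ?E = num_comps G (edges G)"
    using C[of ?E] eE by (simp add: insert_absorb)
  have mono: "num_comps G (edges G) \<le> num_comps G (insert e A)" if "A \<in> Pow ?E" for A
    using that eE by (intro num_comps_antimono[OF G]) auto
  have EC: "edges ?C = ?E" by (simp add: contract_def)
  show ?thesis
    unfolding rank_poly_split[OF G eE] rank_poly_def[of x y ?C] sum_distrib_left EC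
    by (intro sum.cong) (simp_all add: E C less mono V Suc_diff_le, simp_all add: algebra_simps)
qed

lemma rank_poly_ordinary:
  assumes G: "finite_graph G" and eE: "e \<in> edges G" and nl: "\<not> is_loop G e"
    and nb: "\<not> is_bridge G e" and e: "ends G e = Upair u v"
  shows "rank_poly x y G = rank_poly x y (delete G e) + rank_poly x y (contract G e u v)"
proof -
  let ?E = "edges G - {e}" and ?C = "contract G e u v"
  have r: "(u, v) \<in> reach_by G ?E"
    using nb e eE by (auto simp: is_bridge_def reach_eq_reach_by)
  have uv: "u \<in> verts G" "v \<in> verts G" using finite_graph_ends[OF G eE e] by auto
  have "u \<noteq> v" using nl eE e by (auto simp: is_loop_def)
  have V: "card (verts G) = Suc (card (verts ?C))"
    using card_verts_contract[OF G uv \<open>u \<noteq> v\<close>] .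
  have C: "num_comps ?C A = num_comps G (insert e A)" if "A \<in> Pow ?E" for A
    using that by (intro num_comps_contract[OF e]) auto
  have E: "num_comps ?C ?E = num_comps G (edges G)"
    using C[of ?E] eE by (simp add: insert_absorb)
  have ED: "num_comps G ?E = num_comps G (edges G)"
    using num_comps_insert_same[OF e r] eE by (simp add: insert_absorb)
  have EC: "edges ?C = ?E" by (simp add: contract_def)
  have D: "edges (delete G e) = ?E" "verts (delete G e) = verts G" by (simp_all add: delete_def)
  show ?thesis
    unfolding rank_poly_split[OF G eE] rank_poly_def[of x y ?C] rank_poly_def[of x y "delete G e"]
      sum.distrib[symmetric] EC D
    by (intro sum.cong) (simp_all add: E ED C V)
qed

lemma tutte_rel_imp_rank_poly: "tutte_rel G P \<Longrightarrow> finite_graph G \<Longrightarrow> P = rank_poly var_x var_y G"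
proof (induction rule: tutte_rel.induct)
  case (empty G)
  then show ?case by (simp add: rank_poly_def num_comps_empty)
next
  case (loop G e P)
  then show ?case by (metis rank_poly_loop finite_graph_delete)
next
  case (bridge G e u v P)
  then show ?case by (metis rank_poly_bridge finite_graph_contract)
next
  case (ordinary e G u v P P')
  then show ?case
    by (metis rank_poly_ordinary finite_graph_delete finite_graph_contract)
qed

lemma tutte_rel_ex: "finite_graph G \<Longrightarrow> \<exists>P. tutte_rel G P"
proof (induction "card (edges G)" arbitrary: G rule: less_induct)
  case less
  show ?case
  proof (cases "edges G = {}")
    case True
    then show ?thesis by (blast intro: tutte_rel.empty)
  next
    case False
    then obtain e where e: "e \<in> edges G" by auto
    obtain u v where uv: "ends G e = Upair u v" by (cases "ends G e") auto
    have lt: "card (edges G - {e}) < card (edges G)"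
      using e less.prems by (intro card_Diff1_less) (auto simp: finite_graph_def)
    have "\<exists>P. tutte_rel (delete G e) P"
      by (rule less.hyps[OF _ finite_graph_delete[OF less.prems]]) (simp add: delete_def lt)
    moreover have "\<exists>P. tutte_rel (contract G e u v) P"
      by (rule less.hyps[OF _ finite_graph_contract[OF less.prems]]) (simp add: contract_def lt)
    ultimately obtain P P' where "tutte_rel (delete G e) P" "tutte_rel (contract G e u v) P'"
      by auto
    then show ?thesis
      using e uv by (cases "is_loop G e"; cases "is_bridge G e") (blast intro: tutte_rel.intros)+
  qed
qed

theorem tutte_rel_ex1: "finite_graph G \<Longrightarrow> \<exists>!P. tutte_rel G P"
  using tutte_rel_ex tutte_rel_imp_rank_poly by blast

lemma tutte_eqI: "finite_graph G \<Longrightarrow> tutte_rel G P \<Longrightarrow> tutte G = P"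
  unfolding tutte_def by (rule the1_equality[OF tutte_rel_ex1])

lemma tutte_rel_tutte: "finite_graph G \<Longrightarrow> tutte_rel G (tutte G)"
  unfolding tutte_def by (rule theI'[OF tutte_rel_ex1])

theorem tutte_recursion:
  assumes "finite_graph G"
  shows tutte_empty: "edges G = {} \<Longrightarrow> tutte G = 1"
    and tutte_loop: "is_loop G e \<Longrightarrow> tutte G = var_y * tutte (delete G e)"
    and tutte_bridge: "is_bridge G e \<Longrightarrow> ends G e = Upair u v \<Longrightarrow>
      tutte G = var_x * tutte (contract G e u v)"
    and tutte_ordinary: "e \<in> edges G \<Longrightarrow> \<not> is_loop G e \<Longrightarrow> \<not> is_bridge G e \<Longrightarrow>
      ends G e = Upair u v \<Longrightarrow> tutte G = tutte (delete G e) + tutte (contract G e u v)"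
proof -
  note eq = tutte_eqI[OF assms]
  note D = tutte_rel_tutte[OF finite_graph_delete[OF assms]]
  note C = tutte_rel_tutte[OF finite_graph_contract[OF assms]]
  show "edges G = {} \<Longrightarrow> tutte G = 1"
    by (rule eq[OF tutte_rel.empty])
  show "is_loop G e \<Longrightarrow> tutte G = var_y * tutte (delete G e)"
    by (rule eq[OF tutte_rel.loop[OF _ D]])
  show "is_bridge G e \<Longrightarrow> ends G e = Upair u v \<Longrightarrow> tutte G = var_x * tutte (contract G e u v)"
    by (rule eq[OF tutte_rel.bridge[OF _ _ C]])
  show "e \<in> edges G \<Longrightarrow> \<not> is_loop G e \<Longrightarrow> \<not> is_bridge G e \<Longrightarrow>
      ends G e = Upair u v \<Longrightarrow> tutte G = tutte (delete G e) + tutte (contract G e u v)"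
    by (rule eq[OF tutte_rel.ordinary[OF _ _ _ _ D C]])
qed


section \<open>Tiered graphs with two tiers\<close>

text \<open>The tiering function is \<open>undefined\<close> outside the vertex set, so two tiered graphs on the same
  vertices are equal iff they have the same edges and the same tiers.\<close>

record tgraph =
  tverts :: "nat set"
  tedges :: "nat uprod set"
  tier :: "nat \<Rightarrow> nat"

definition tiered_graph :: "tgraph \<Rightarrow> bool" where
  "tiered_graph Q \<longleftrightarrow>
     finite (tverts Q) \<and> (\<forall>v\<in>tverts Q. 0 < v) \<and>
     tedges Q \<subseteq> {Upair v v' | v v'. v \<in> tverts Q \<and> v' \<in> tverts Q \<and> v \<noteq> v'} \<and>
     tier Q \<in> tverts Q \<rightarrow>\<^sub>E {1, 2} \<and>
     (\<forall>v v'. Upair v v' \<in> tedges Q \<and> v > v' \<longrightarrow> tier Q v > tier Q v')"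

definition tier_set :: "nat \<Rightarrow> tgraph \<Rightarrow> nat set" where
  "tier_set i Q = {v \<in> tverts Q. tier Q v = i}"

definition complete_tiered :: "tgraph \<Rightarrow> bool" where
  "complete_tiered Q \<longleftrightarrow> tiered_graph Q \<and>
     tedges Q = {Upair u v | u v. u \<in> tier_set 1 Q \<and> v \<in> tier_set 2 Q \<and> u < v}"

definition CT :: "nat set \<Rightarrow> nat \<times> nat \<Rightarrow> tgraph set" where
  "CT U p = {Q. complete_tiered Q \<and> tverts Q = U \<and>
     card (tier_set 1 Q) = fst p \<and> card (tier_set 2 Q) = snd p}"

lemma bij_betw_CT:
  assumes "finite U" "\<forall>u\<in>U. 0 < u" "p\<^sub>1 + p\<^sub>2 = card U"
  shows "bij_betw (tier_set 1) (CT U (p\<^sub>1, p\<^sub>2)) {S. S \<subseteq> U \<and> card S = p\<^sub>1}"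
proof (rule bij_betw_byWitness)
  define t where "t S = restrict (\<lambda>u. if u \<in> S then 1 else 2 :: nat) U" for S
  define F where "F S = \<lparr>tverts = U,
    tedges = {Upair u v | u v. u \<in> S \<and> v \<in> U - S \<and> u < v}, tier = t S\<rparr>" for S
  have t1: "t S u = 1 \<longleftrightarrow> u \<in> S" and t2: "t S u = 2 \<longleftrightarrow> u \<notin> S" if "u \<in> U" for S u
    using that by (simp_all add: t_def)
  have F1: "tier_set 1 (F S) = S" and F2: "tier_set 2 (F S) = U - S" if "S \<subseteq> U" for S
    using that t1 t2 by (auto simp: tier_set_def F_def)
  have split: "tier Q \<in> U \<rightarrow>\<^sub>E {1, 2}" "tier_set 1 Q \<subseteq> U" "tier_set 2 Q = U - tier_set 1 Q"
    "tverts Q = U"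
    if "Q \<in> CT U (p\<^sub>1, p\<^sub>2)" for Q
    using that by (auto simp: CT_def complete_tiered_def tiered_graph_def tier_set_def PiE_iff)
  show "\<forall>Q\<in>CT U (p\<^sub>1, p\<^sub>2). F (tier_set 1 Q) = Q"
  proof
    fix Q assume Q: "Q \<in> CT U (p\<^sub>1, p\<^sub>2)"
    have "t (tier_set 1 Q) u = tier Q u" for u
      using split(1,4)[OF Q] by (auto simp: t_def restrict_def tier_set_def PiE_iff extensional_def)
    then have "t (tier_set 1 Q) = tier Q" ..
    moreover have "tedges Q = {Upair u v | u v. u \<in> tier_set 1 Q \<and> v \<in> U - tier_set 1 Q \<and> u < v}"
      using Q split(3)[OF Q] by (simp add: CT_def complete_tiered_def)
    ultimately show "F (tier_set 1 Q) = Q"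
      using split(4)[OF Q] by (simp add: F_def)
  qed
  show "\<forall>S\<in>{S. S \<subseteq> U \<and> card S = p\<^sub>1}. tier_set 1 (F S) = S"
    using F1 by blast
  show "tier_set 1 ` CT U (p\<^sub>1, p\<^sub>2) \<subseteq> {S. S \<subseteq> U \<and> card S = p\<^sub>1}"
    using split(2) by (auto simp: CT_def)
  show "F ` {S. S \<subseteq> U \<and> card S = p\<^sub>1} \<subseteq> CT U (p\<^sub>1, p\<^sub>2)"
  proof clarify
    fix S assume S: "S \<subseteq> U" "p\<^sub>1 = card S"
    have "card (U - S) = p\<^sub>2"
      using S assms(1,3) by (simp add: card_Diff_subset finite_subset)
    moreover have "tiered_graph (F S)"
      unfolding tiered_graph_def
    proof (intro conjI)
      show "\<forall>v v'. Upair v v' \<in> tedges (F S) \<and> v > v' \<longrightarrow> tier (F S) v > tier (F S) v'"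
        using S by (auto simp: F_def t_def)
      show "tedges (F S) \<subseteq>
          {Upair v v' | v v'. v \<in> tverts (F S) \<and> v' \<in> tverts (F S) \<and> v \<noteq> v'}"
        using S by (fastforce simp: F_def)
    qed (use assms in \<open>auto simp: F_def t_def\<close>)
    ultimately show "F S \<in> CT U (card S, p\<^sub>2)"
      using S F1 F2 by (simp add: CT_def complete_tiered_def) (simp add: F_def)
  qed
qed

corollary
  assumes "finite U" "\<forall>u\<in>U. 0 < u" "p\<^sub>1 + p\<^sub>2 = card U"
  shows finite_CT: "finite (CT U (p\<^sub>1, p\<^sub>2))"
    and card_CT: "card (CT U (p\<^sub>1, p\<^sub>2)) = card U choose p\<^sub>1"
proof -
  have "finite {S. S \<subseteq> U \<and> card S = p\<^sub>1}" using assms(1) by simp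
  then show "finite (CT U (p\<^sub>1, p\<^sub>2))" using bij_betw_finite[OF bij_betw_CT[OF assms]] by simp
  show "card (CT U (p\<^sub>1, p\<^sub>2)) = card U choose p\<^sub>1"
    using bij_betw_same_card[OF bij_betw_CT[OF assms]] n_subsets[OF assms(1)] by simp
qed

text \<open>The vertices of \<open>H\<close> are natural numbers (\<open>Inl\<close>) or arbitrary other objects (\<open>Inr\<close>).
  Using a sum type for the edges makes the union of the edge sets disjoint.\<close>

definition graph_union ::
    "(nat + 'a, 'e) mgraph \<Rightarrow> tgraph \<Rightarrow> (nat + 'a, 'e + nat uprod) mgraph" where
  "graph_union H Q = \<lparr>verts = verts H, edges = edges H <+> tedges Q,
     ends = case_sum (ends H) (map_uprod Inl)\<rparr>"

lemma finite_graph_union: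
  assumes "finite_graph H" "Inl ` U \<subseteq> verts H" "tiered_graph Q" "tverts Q = U"
  shows "finite_graph (graph_union H Q)"
proof -
  have Q: "tedges Q \<subseteq> {Upair u v | u v. u \<in> U \<and> v \<in> U \<and> u \<noteq> v}" "finite U"
    using assms(3,4) by (simp_all add: tiered_graph_def)
  then have "tedges Q \<subseteq> (\<lambda>(u, v). Upair u v) ` (U \<times> U)" by blast
  moreover have "finite ((\<lambda>(u, v). Upair u v) ` (U \<times> U))" using Q(2) by simp
  ultimately have "finite (tedges Q)" by (rule finite_subset)
  moreover have "set_uprod (map_uprod Inl e) \<subseteq> verts H" if e: "e \<in> tedges Q" for e
  proof -
    obtain u v where "e = Upair u v" "u \<in> U" "v \<in> U" using e Q(1) by blast
    then show ?thesis using assms(2) by auto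
  qed
  ultimately show ?thesis
    using assms(1) by (simp add: finite_graph_def graph_union_def ball_Un Plus_def)
qed

end

theory Submission
  imports Defs
begin

text \<open>At \<open>x = 1\<close> only the connected spanning edge sets contribute to the
  rank-generating polynomial of a connected graph, each with a weight depending on its size alone.
  Hence both sides of the theorem are sums over pairs of a tiering and an edge set \<open>A\<close>
  whose reachability relation is everything. By Moebius inversion over the equivalence relations
  \<open>\<sigma>\<close> on the vertices it is enough to compare the sums over pairs where
  \<open>A\<close> only joins \<open>\<sigma>\<close>-equivalent vertices. For a given tiering such
  a sum depends only on the number of available edges, and this number is preserved when
  \<open>V\<^sub>1\<close> is replaced by the image of its complement under a permutation of
  \<open>U\<close> that reverses the order of every \<open>\<sigma>\<close>-class.\<close>

section \<open>Reversing the order of every class\<close>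

text \<open>Swap the minimum and the maximum and reverse what remains by induction. If the two
  coincide, the set is a singleton and the swap is the identity.\<close>

lemma ex_order_reversing_bij:
  fixes C :: "'a::linorder set"
  assumes "finite C"
  shows "\<exists>\<phi>. bij_betw \<phi> C C \<and> (\<forall>u\<in>C. \<forall>v\<in>C. u < v \<longrightarrow> \<phi> v < \<phi> u)"
  using assms
proof (induction "card C" arbitrary: C rule: less_induct)
  case less
  show ?case
  proof (cases "C = {}")
    case False
    define a b where "a = Min C" and "b = Max C"
    define D where "D = C - {a, b}"
    have ab: "a \<in> C" "b \<in> C" "\<And>u. u \<in> C \<Longrightarrow> a \<le> u \<and> u \<le> b"
      using less.prems False by (auto simp: a_def b_def)
    have "card D < card C"
      unfolding D_def using ab less.prems by (intro psubset_card_mono) auto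
    then obtain \<phi> where \<phi>: "bij_betw \<phi> D D" "\<forall>u\<in>D. \<forall>v\<in>D. u < v \<longrightarrow> \<phi> v < \<phi> u"
      using less.hyps[of D] less.prems by (auto simp: D_def)
    define \<psi> where "\<psi> u = (if u = a then b else if u = b then a else \<phi> u)" for u
    have "bij_betw \<psi> D D"
      using \<phi>(1) by (subst bij_betw_cong[of _ _ \<phi>]) (auto simp: \<psi>_def D_def)
    moreover have "bij_betw \<psi> {a, b} {a, b}"
      by (auto simp: bij_betw_def inj_on_def \<psi>_def)
    ultimately have "bij_betw \<psi> (D \<union> {a, b}) (D \<union> {a, b})"
      by (rule bij_betw_combine) (auto simp: D_def)
    moreover have "D \<union> {a, b} = C" using ab by (auto simp: D_def)
    moreover have "\<psi> v < \<psi> u" if "u \<in> C" "v \<in> C" "u < v" for u v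
    proof -
      have "u \<noteq> b" "v \<noteq> a" using that ab(3) by (auto simp: not_less[symmetric])
      \<comment> \<open>Settles the pairs with \<open>u = a\<close> or \<open>v = b\<close>: images
        of inner points stay strictly between the extremes.\<close>
      moreover have "a < \<phi> w" "\<phi> w < b" if "w \<in> D" for w
        using that bij_betw_apply[OF \<phi>(1)] ab(3)[of "\<phi> w"] by (auto simp: D_def less_le)
      ultimately show ?thesis
        using that \<phi>(2) ab(3)[of u] ab(3)[of v] by (auto simp: \<psi>_def D_def)
    qed
    ultimately show ?thesis by auto
  qed auto
qed

text \<open>Glue the reversals of the finite classes. Each image stays in its class, so equal images
  come from one class, where injectivity is known; on a finite set this suffices for
  bijectivity.\<close>

lemma ex_class_reversing_bij:
  fixes U :: "'a::linorder set"
  assumes "finite U" "equiv U \<sigma>"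
  shows "\<exists>\<phi>. bij_betw \<phi> U U \<and> (\<forall>u\<in>U. (u, \<phi> u) \<in> \<sigma>) \<and>
    (\<forall>u v. (u, v) \<in> \<sigma> \<and> u < v \<longrightarrow> \<phi> v < \<phi> u)"
proof -
  have fin: "finite (\<sigma> `` {u})" for u
    using assms by (meson equiv_class_subset equiv_type finite_subset Image_subset)
  \<comment> \<open>The choice depends on the class and not on a representative, so equivalent
    points are moved by the same map.\<close>
  define \<phi> where "\<phi> C = (SOME \<phi>. bij_betw \<phi> C C \<and> (\<forall>u\<in>C. \<forall>v\<in>C. u < v \<longrightarrow> \<phi> v < \<phi> u))"
    for C :: "'a set"
  have \<phi>: "bij_betw (\<phi> C) C C" "\<And>u v. u \<in> C \<Longrightarrow> v \<in> C \<Longrightarrow> u < v \<Longrightarrow> \<phi> C v < \<phi> C u"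
    if "finite C" for C
    using someI_ex[OF ex_order_reversing_bij[OF that]] unfolding \<phi>_def[symmetric] by auto
  define \<psi> where "\<psi> u = \<phi> (\<sigma> `` {u}) u" for u
  have self: "u \<in> \<sigma> `` {u}" if "u \<in> U" for u
    using assms(2) that by (rule equiv_class_self)
  have cls: "(u, \<psi> u) \<in> \<sigma>" if "u \<in> U" for u
    using bij_betw_apply[OF \<phi>(1)[OF fin] self[OF that]] by (simp add: \<psi>_def)
  have sub: "\<sigma> \<subseteq> U \<times> U" using assms(2) by (rule equiv_type)
  have "inj_on \<psi> U"
  proof (rule inj_onI)
    fix u v assume u: "u \<in> U" and v: "v \<in> U" and eq: "\<psi> u = \<psi> v"
    have "\<sigma> `` {u} = \<sigma> `` {v}"
      using equiv_class_eq[OF assms(2) cls[OF u]] equiv_class_eq[OF assms(2) cls[OF v]] eq by simp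
    then show "u = v"
      using inj_onD[OF bij_betw_imp_inj_on[OF \<phi>(1)[OF fin]]] eq self[OF u] self[OF v]
      by (metis \<psi>_def)
  qed
  moreover have "\<psi> ` U \<subseteq> U" using cls sub by auto
  ultimately have "bij_betw \<psi> U U"
    using assms(1) by (simp add: bij_betw_def endo_inj_surj)
  moreover have "\<psi> v < \<psi> u" if "(u, v) \<in> \<sigma>" "u < v" for u v
  proof -
    have "u \<in> \<sigma> `` {u}" using that sub self by auto
    then show ?thesis
      using \<phi>(2)[OF fin] that equiv_class_eq[OF assms(2) that(1)] by (metis \<psi>_def Image_singleton_iff)
  qed
  ultimately show ?thesis using cls by blast
qed

text \<open>For \<open>S\<close> the first tier, these pairs are the edges of the complete tiered
  graph that stay inside a class, each written with its smaller end first.\<close>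

definition class_inversions :: "'a::linorder set \<Rightarrow> ('a \<times> 'a) set \<Rightarrow> 'a set \<Rightarrow> ('a \<times> 'a) set" where
  "class_inversions U \<sigma> S = {(u, v). u \<in> S \<and> v \<in> U - S \<and> u < v \<and> (u, v) \<in> \<sigma>}"

text \<open>Send \<open>S\<close> to the image of \<open>U - S\<close> under a class-reversing
  \<phi>, which turns size \<open>p\<close> into size \<open>q\<close>. Complementing exchanges the
  roles of the two entries of an inversion and the reversal restores their order, so the number of
  inversions is kept.\<close>

lemma sum_class_inversions_symmetric:
  fixes U :: "'a::linorder set" and f :: "nat \<Rightarrow> 'r::comm_monoid_add"
  assumes "finite U" "equiv U \<sigma>" "p + q = card U"
  shows "(\<Sum>S | S \<subseteq> U \<and> card S = p. f (card (class_inversions U \<sigma> S))) =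
    (\<Sum>S | S \<subseteq> U \<and> card S = q. f (card (class_inversions U \<sigma> S)))"
proof -
  obtain \<phi> where bij: "bij_betw \<phi> U U" and cls: "\<And>u. u \<in> U \<Longrightarrow> (u, \<phi> u) \<in> \<sigma>"
    and rev: "\<And>u v. (u, v) \<in> \<sigma> \<Longrightarrow> u < v \<Longrightarrow> \<phi> v < \<phi> u"
    using ex_class_reversing_bij[OF assms(1,2)] by blast
  have inj: "inj_on \<phi> U" and im: "\<phi> ` U = U" using bij by (auto simp: bij_betw_def)
  have sub: "\<sigma> \<subseteq> U \<times> U" using assms(2) by (rule equiv_type)
  have sym: "(u, v) \<in> \<sigma> \<Longrightarrow> (v, u) \<in> \<sigma>" and trans: "(u, v) \<in> \<sigma> \<Longrightarrow> (v, w) \<in> \<sigma> \<Longrightarrow> (u, w) \<in> \<sigma>"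
    for u v w using assms(2) by (meson equivE symD transD)+
  have cls_iff: "(\<phi> u, \<phi> v) \<in> \<sigma> \<longleftrightarrow> (u, v) \<in> \<sigma>" if "u \<in> U" "v \<in> U" for u v
    using cls[OF that(1)] cls[OF that(2)] by (meson sym trans)
  have rev_iff: "\<phi> v < \<phi> u \<longleftrightarrow> u < v" if "(u, v) \<in> \<sigma>" for u v
    using rev[OF that] rev[OF sym[OF that]] by (metis neqE order_less_asym)
  define T where "T S = \<phi> ` (U - S)" for S
  have T_compl: "U - T S = \<phi> ` S" if "S \<subseteq> U" for S
    using that inj im by (metis T_def double_diff inj_on_image_set_diff Diff_subset subset_refl)
  have bij_T: "bij_betw T {S. S \<subseteq> U \<and> card S = p} {S. S \<subseteq> U \<and> card S = q}"
  proof (rule bij_betw_imageI)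
    show "inj_on T {S. S \<subseteq> U \<and> card S = p}"
    proof (rule inj_onI, clarify)
      fix S S' assume S: "S \<subseteq> U" and S': "S' \<subseteq> U" and eq: "T S = T S'"
      then have "\<phi> ` S = \<phi> ` S'" using T_compl by metis
      then show "S = S'" using inj_on_image_eq_iff[OF inj S S'] by simp
    qed
    have card_T: "card (T S) = card U - card S" if "S \<subseteq> U" for S
      using that assms(1) inj
      by (simp add: T_def card_image card_Diff_subset finite_subset inj_on_diff)
    show "T ` {S. S \<subseteq> U \<and> card S = p} = {S. S \<subseteq> U \<and> card S = q}"
    proof (intro equalityI subsetI)
      fix R assume "R \<in> T ` {S. S \<subseteq> U \<and> card S = p}"
      then obtain S where S: "S \<subseteq> U" "card S = p" "R = T S" by blast
      then have "T S \<subseteq> U" using im by (auto simp: T_def)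
      then show "R \<in> {S. S \<subseteq> U \<and> card S = q}" using S card_T[of S] assms(3) by simp
    next
      fix R assume "R \<in> {S. S \<subseteq> U \<and> card S = q}"
      then have R: "R \<subseteq> U" "card R = q" by auto
      \<comment> \<open>The preimage of \<open>R\<close> under \<open>T\<close>: its complement has
        to be what \<phi> maps onto \<open>R\<close>.\<close>
      define S where "S = U - {u \<in> U. \<phi> u \<in> R}"
      have "U - S = {u \<in> U. \<phi> u \<in> R}" by (auto simp: S_def)
      then have "T S = R" using R(1) im by (auto simp: T_def image_iff)
      moreover have "S \<subseteq> U" by (auto simp: S_def)
      \<comment> \<open>Rules out truncation of the subtraction in \<open>card_T\<close>, so that
        \<open>card S = p\<close> can be recovered.\<close>
      moreover from this have "card S \<le> card U" using assms(1) by (simp add: card_mono)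
      ultimately show "R \<in> T ` {S. S \<subseteq> U \<and> card S = p}"
        using card_T[of S] R(2) assms(3) by force
    qed
  qed
  have "card (class_inversions U \<sigma> (T S)) = card (class_inversions U \<sigma> S)"
    if S: "S \<subseteq> U" for S
  proof -
    \<comment> \<open>For \<open>u\<close> in \<open>S\<close> and \<open>v\<close> outside,
      \<open>\<phi> v\<close> lies in \<open>T S\<close> and \<open>\<phi> u\<close> outside; hence
      the exchange of the entries.\<close>
    have "bij_betw (\<lambda>(u, v). (\<phi> v, \<phi> u)) (class_inversions U \<sigma> S) (class_inversions U \<sigma> (T S))"
    proof (rule bij_betw_imageI)
      show "inj_on (\<lambda>(u, v). (\<phi> v, \<phi> u)) (class_inversions U \<sigma> S)"
        using S by (auto simp: inj_on_def class_inversions_def dest: inj_onD[OF inj])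
      show "(\<lambda>(u, v). (\<phi> v, \<phi> u)) ` class_inversions U \<sigma> S = class_inversions U \<sigma> (T S)"
      proof (intro equalityI subsetI)
        fix x assume "x \<in> (\<lambda>(u, v). (\<phi> v, \<phi> u)) ` class_inversions U \<sigma> S"
        then obtain u v where "x = (\<phi> v, \<phi> u)" "u \<in> S" "v \<in> U - S" "u < v" "(u, v) \<in> \<sigma>"
          by (auto simp: class_inversions_def)
        then show "x \<in> class_inversions U \<sigma> (T S)"
          using S T_compl[OF S] cls_iff[of v u] sym rev
          by (auto simp: class_inversions_def) (auto simp: T_def)
      next
        fix x assume "x \<in> class_inversions U \<sigma> (T S)"
        then obtain a b where x: "x = (a, b)" "a \<in> T S" "b \<in> \<phi> ` S" "a < b" "(a, b) \<in> \<sigma>"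
          unfolding class_inversions_def T_compl[OF S] by auto
        then obtain u v where "a = \<phi> v" "v \<in> U - S" "b = \<phi> u" "u \<in> S" by (auto simp: T_def)
        moreover from this have "(u, v) \<in> \<sigma>" using x cls_iff[of v u] S sym by auto
        ultimately show "x \<in> (\<lambda>(u, v). (\<phi> v, \<phi> u)) ` class_inversions U \<sigma> S"
          using x rev_iff[of u v] by (intro image_eqI[of _ _ "(u, v)"]) (auto simp: class_inversions_def)
      qed
    qed
    then show ?thesis by (simp add: bij_betw_same_card)
  qed
  then have "(\<Sum>S | S \<subseteq> U \<and> card S = p. f (card (class_inversions U \<sigma> S))) =
      (\<Sum>S | S \<subseteq> U \<and> card S = p. f (card (class_inversions U \<sigma> (T S))))"
    by (intro sum.cong) auto
  also have "\<dots> = (\<Sum>S | S \<subseteq> U \<and> card S = q. f (card (class_inversions U \<sigma> S)))"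
    by (rule sum.reindex_bij_betw[OF bij_T])
  finally show ?thesis .
qed

section \<open>Sums over the subsets of a set\<close>

lemma sum_Pow_card_cong:
  fixes w :: "nat \<Rightarrow> 'r::comm_monoid_add"
  assumes "finite A" "finite B" "card A = card B"
  shows "(\<Sum>D\<in>Pow A. w (card D)) = (\<Sum>D\<in>Pow B. w (card D))"
proof -
  obtain h where h: "bij_betw h A B" using assms finite_same_card_bij by blast
  have "(\<Sum>D\<in>Pow B. w (card D)) = (\<Sum>D\<in>Pow A. w (card (h ` D)))"
    by (rule sum.reindex_bij_betw[OF bij_betw_Pow[OF h], symmetric])
  also have "\<dots> = (\<Sum>D\<in>Pow A. w (card D))"
    using h by (intro sum.cong refl arg_cong[of _ _ w] card_image)
      (auto simp: bij_betw_def intro: inj_on_subset)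
  finally show ?thesis ..
qed

text \<open>Moebius inversion carried out as an induction: the sum below \<sigma> is the fibre over
  \<sigma> plus the fibres over the strictly smaller members of \<open>C\<close>, and the latter
  agree by the induction hypothesis.\<close>

lemma sum_fibres_eq_if_sums_below_eq:
  fixes f :: "'a \<Rightarrow> 'c set" and g :: "'b \<Rightarrow> 'c set" and w :: "'a \<Rightarrow> 'r::ab_group_add"
  assumes "finite X" "finite Y" "f ` X \<subseteq> C" "g ` Y \<subseteq> C"
    and below: "\<And>\<sigma>. \<sigma> \<in> C \<Longrightarrow> (\<Sum>x | x \<in> X \<and> f x \<subseteq> \<sigma>. w x) = (\<Sum>y | y \<in> Y \<and> g y \<subseteq> \<sigma>. w' y)"
    and "finite \<sigma>" "\<sigma> \<in> C"
  shows "(\<Sum>x | x \<in> X \<and> f x = \<sigma>. w x) = (\<Sum>y | y \<in> Y \<and> g y = \<sigma>. w' y)"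
  using assms(6,7)
proof (induction \<sigma> rule: finite_psubset_induct)
  case (psubset \<sigma>)
  \<comment> \<open>Polymorphic in the index type, since it is applied to both \<open>X\<close> and
    \<open>Y\<close>.\<close>
  have split: "(\<Sum>x | x \<in> Z \<and> h x \<subseteq> \<sigma>. u x) = (\<Sum>x | x \<in> Z \<and> h x = \<sigma>. u x) +
      (\<Sum>\<tau> | \<tau> \<in> C \<and> \<tau> \<subset> \<sigma>. \<Sum>x | x \<in> Z \<and> h x = \<tau>. u x)"
    if "finite Z" "h ` Z \<subseteq> C" for Z and h :: "'d \<Rightarrow> 'c set" and u :: "'d \<Rightarrow> 'r"
  proof -
    have "{x. x \<in> Z \<and> h x \<subseteq> \<sigma>} = {x \<in> Z. h x = \<sigma>} \<union> {x \<in> Z. h x \<subset> \<sigma>}" by auto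
    then have "(\<Sum>x | x \<in> Z \<and> h x \<subseteq> \<sigma>. u x) =
        (\<Sum>x | x \<in> Z \<and> h x = \<sigma>. u x) + (\<Sum>x | x \<in> Z \<and> h x \<subset> \<sigma>. u x)"
      using that(1) by (simp add: sum.union_disjoint disjoint_iff)
    also have "(\<Sum>x | x \<in> Z \<and> h x \<subset> \<sigma>. u x) =
        (\<Sum>\<tau> | \<tau> \<in> C \<and> \<tau> \<subset> \<sigma>. \<Sum>x | x \<in> {x \<in> Z. h x \<subset> \<sigma>} \<and> h x = \<tau>. u x)"
      using that psubset.hyps
      by (intro sum.group[symmetric]) (auto intro: finite_subset[of _ "Pow \<sigma>"])
    also have "\<dots> = (\<Sum>\<tau> | \<tau> \<in> C \<and> \<tau> \<subset> \<sigma>. \<Sum>x | x \<in> Z \<and> h x = \<tau>. u x)"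
      by (intro sum.cong refl) auto
    finally show ?thesis .
  qed
  have "(\<Sum>\<tau> | \<tau> \<in> C \<and> \<tau> \<subset> \<sigma>. \<Sum>x | x \<in> X \<and> f x = \<tau>. w x) =
      (\<Sum>\<tau> | \<tau> \<in> C \<and> \<tau> \<subset> \<sigma>. \<Sum>y | y \<in> Y \<and> g y = \<tau>. w' y)"
    using psubset.IH by (intro sum.cong) auto
  then show ?case
    using below[OF psubset.prems] split[OF assms(1,3), of w] split[OF assms(2,4), of w'] by simp
qed

section \<open>Connected spanning edge sets\<close>

text \<open>\<open>reach_by\<close> also relates every point outside the graph to itself; cutting
  down to the vertices gives an equivalence relation on them.\<close>

definition reach_rel :: "('v, 'e) mgraph \<Rightarrow> 'e set \<Rightarrow> ('v \<times> 'v) set" where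
  "reach_rel G A = reach_by G A \<inter> verts G \<times> verts G"

text \<open>Squaring the set of ends avoids ordering them. The diagonal pairs cost nothing when
  \<sigma> is reflexive on the vertices.\<close>

definition edge_within :: "('v \<times> 'v) set \<Rightarrow> 'v uprod \<Rightarrow> bool" where
  "edge_within \<sigma> e \<longleftrightarrow> set_uprod e \<times> set_uprod e \<subseteq> \<sigma>"

lemma equiv_reach_rel: "equiv (verts G) (reach_rel G A)"
  by (rule equivI) (auto simp: reach_rel_def intro!: refl_onI symI transI
    intro: reach_by_sym reach_by_trans)

text \<open>Reachability is the least equivalence relation containing the edges. Containment thus
  becomes a condition on single edges, and the sets \<open>A\<close> satisfying it form a full power
  set.\<close>

lemma reach_rel_subset_iff:
  assumes "finite_graph G" "A \<subseteq> edges G" "equiv (verts G) \<sigma>"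
  shows "reach_rel G A \<subseteq> \<sigma> \<longleftrightarrow> (\<forall>e\<in>A. edge_within \<sigma> (ends G e))"
proof
  assume L: "reach_rel G A \<subseteq> \<sigma>"
  show "\<forall>e\<in>A. edge_within \<sigma> (ends G e)"
  proof
    fix e assume e: "e \<in> A"
    obtain u v where uv: "ends G e = Upair u v" by (cases "ends G e") auto
    have "u \<in> verts G \<and> v \<in> verts G" using finite_graph_ends[OF assms(1) _ uv] e assms(2) by auto
    then show "edge_within \<sigma> (ends G e)"
      using L uv reach_by_edge[OF e uv] reach_by_sym[OF reach_by_edge[OF e uv]]
      by (auto simp: edge_within_def reach_rel_def)
  qed
next
  assume R: "\<forall>e\<in>A. edge_within \<sigma> (ends G e)"
  have "(a, b) \<in> \<sigma>" if "(a, b) \<in> reach_by G A" "a \<in> verts G" for a b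
    using that(1) unfolding reach_by_def
  proof (induction rule: rtrancl_induct)
    case base
    then show ?case using assms(3) that(2) by (meson equivE refl_onD)
  next
    case (step y z)
    then have "(y, z) \<in> \<sigma>" using R by (force simp: edge_within_def)
    then show ?case using step.IH assms(3) by (meson equivE transD)
  qed
  then show "reach_rel G A \<subseteq> \<sigma>" by (auto simp: reach_rel_def)
qed

lemma num_comps_eq_1_iff:
  assumes "finite (verts G)" "verts G \<noteq> {}"
  shows "num_comps G A = 1 \<longleftrightarrow> reach_rel G A = verts G \<times> verts G"
proof -
  define f where "f v = reach_by G A `` {v}" for v
  obtain a where a: "a \<in> verts G" using assms(2) by blast
  have "num_comps G A = 1 \<longleftrightarrow> (\<exists>c. f ` verts G = {c})"
    unfolding num_comps_def f_def by (simp add: card_1_singleton_iff)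
  also have "\<dots> \<longleftrightarrow> (\<forall>u\<in>verts G. \<forall>v\<in>verts G. f u = f v)"
  proof
    assume "\<forall>u\<in>verts G. \<forall>v\<in>verts G. f u = f v"
    then have "f ` verts G = {f a}" using a by blast
    then show "\<exists>c. f ` verts G = {c}" by blast
  qed blast
  finally have "num_comps G A = 1 \<longleftrightarrow>
      (\<forall>u\<in>verts G. \<forall>v\<in>verts G. reach_by G A `` {u} = reach_by G A `` {v})"
    unfolding f_def .
  then show ?thesis unfolding reach_class_eq_iff by (auto simp: reach_rel_def)
qed

lemma num_comps_pos: "finite (verts G) \<Longrightarrow> verts G \<noteq> {} \<Longrightarrow> 0 < num_comps G A"
  by (simp add: num_comps_def card_gt_0_iff)

lemma connected_graph_iff:
  "connected_graph G \<longleftrightarrow> verts G \<noteq> {} \<and> reach_rel G (edges G) = verts G \<times> verts G"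
  by (auto simp: connected_graph_def reach_rel_def reach_def reach_by_def)

lemma tutte_eq_rank_poly: "finite_graph G \<Longrightarrow> tutte G = rank_poly var_x var_y G"
  by (simp add: tutte_rel_imp_rank_poly tutte_rel_tutte)

text \<open>At \<open>x = 1\<close> the factor \<open>(x - 1) ^ (num_comps G A - 1)\<close> of the
  rank-generating polynomial is a power of 0, equal to 1 exactly when \<open>A\<close> leaves one
  component; the exponent of \<open>y - 1\<close> simplifies accordingly.\<close>

lemma poly_tutte_1_connected:
  assumes "finite_graph G" "connected_graph G"
  shows "poly (tutte G) 1 = (\<Sum>A | A \<subseteq> edges G \<and> reach_rel G A = verts G \<times> verts G.
    ([:0, 1:] - 1) ^ (Suc (card A) - card (verts G)))"
proof -
  have V: "finite (verts G)" "verts G \<noteq> {}" "finite (edges G)"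
    using assms by (auto simp: finite_graph_def connected_graph_def)
  have E: "num_comps G (edges G) = 1"
    using assms(2) num_comps_eq_1_iff[OF V(1,2)] by (simp add: connected_graph_iff)
  have "poly (tutte G) 1 = (\<Sum>A\<in>Pow (edges G). 0 ^ (num_comps G A - 1) *
      ([:0, 1:] - 1) ^ (num_comps G A + card A - card (verts G)))"
    by (simp add: tutte_eq_rank_poly[OF assms(1)] rank_poly_def poly_sum E)
  also have "\<dots> = (\<Sum>A | A \<subseteq> edges G \<and> reach_rel G A = verts G \<times> verts G.
      0 ^ (num_comps G A - 1) * ([:0, 1:] - 1) ^ (num_comps G A + card A - card (verts G)))"
  proof (rule sum.mono_neutral_right, goal_cases)
    \<comment> \<open>The discarded terms vanish because they carry a positive power of 0.\<close>
    case 3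
    have "num_comps G A > 1" if "reach_rel G A \<noteq> verts G \<times> verts G" for A
      using that num_comps_eq_1_iff[OF V(1,2), of A] num_comps_pos[OF V(1,2), of A] by linarith
    then show ?case by (force simp: power_0_left)
  qed (use V in auto)
  also have "\<dots> = (\<Sum>A | A \<subseteq> edges G \<and> reach_rel G A = verts G \<times> verts G.
      ([:0, 1:] - 1) ^ (Suc (card A) - card (verts G)))"
    using num_comps_eq_1_iff[OF V(1,2), THEN iffD2] by (intro sum.cong) auto
  finally show ?thesis .
qed

section \<open>Unions with a complete tiered graph\<close>

lemma CT_D:
  assumes "Q \<in> CT U (p, q)"
  shows "tiered_graph Q" "tverts Q = U" "tier_set 1 Q \<subseteq> U"
    and "tedges Q = {Upair u v | u v. u \<in> tier_set 1 Q \<and> v \<in> U - tier_set 1 Q \<and> u < v}"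
proof -
  show 1: "tiered_graph Q" "tverts Q = U" "tier_set 1 Q \<subseteq> U"
    using assms by (auto simp: CT_def complete_tiered_def tier_set_def)
  have "tier_set 2 Q = U - tier_set 1 Q"
    using 1 by (auto simp: tiered_graph_def tier_set_def PiE_iff)
  then show "tedges Q = {Upair u v | u v. u \<in> tier_set 1 Q \<and> v \<in> U - tier_set 1 Q \<and> u < v}"
    using assms by (simp add: CT_def complete_tiered_def)
qed

text \<open>The smaller end of every edge lies in the first tier, so the unordered pair determines
  the ordered one.\<close>

lemma card_tedges_within:
  assumes "Q \<in> CT U (p, q)" "equiv U \<sigma>"
  shows "card {e \<in> tedges Q. edge_within \<sigma> e} = card (class_inversions U \<sigma> (tier_set 1 Q))"
proof -
  have within: "edge_within \<sigma> (Upair u v) \<longleftrightarrow> (u, v) \<in> \<sigma>" if "u \<in> U" "v \<in> U" for u v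
    using that assms(2) by (auto simp: edge_within_def elim!: equivE dest: refl_onD symD)
  have "bij_betw (\<lambda>(u, v). Upair u v) (class_inversions U \<sigma> (tier_set 1 Q))
    {e \<in> tedges Q. edge_within \<sigma> e}"
  proof (rule bij_betw_imageI)
    show "inj_on (\<lambda>(u, v). Upair u v) (class_inversions U \<sigma> (tier_set 1 Q))"
      by (auto simp: inj_on_def class_inversions_def)
    show "(\<lambda>(u, v). Upair u v) ` class_inversions U \<sigma> (tier_set 1 Q) =
        {e \<in> tedges Q. edge_within \<sigma> e}"
      using CT_D(3)[OF assms(1)] within unfolding CT_D(4)[OF assms(1)] class_inversions_def
      by (auto simp: image_iff subset_iff)
  qed
  then show ?thesis by (simp add: bij_betw_same_card)
qed

text \<open>The available edges are those of \<open>H\<close>, the same for every \<open>Q\<close>,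
  together with one for each inversion inside a class. So the inner sum is a function of the number
  of inversions, and the symmetry of inversion counts applies.\<close>

lemma sum_within_symmetric:
  fixes H :: "(nat + 'a, 'e) mgraph" and w :: "nat \<Rightarrow> 'r::comm_monoid_add"
  assumes "finite U" "\<forall>u\<in>U. 0 < u" "p + q = card U" "finite_graph H" "Inl ` U \<subseteq> verts H"
    and "equiv (verts H) \<sigma>"
  defines "E \<equiv> \<lambda>Q. {e \<in> edges (graph_union H Q). edge_within \<sigma> (ends (graph_union H Q) e)}"
  shows "(\<Sum>Q\<in>CT U (p, q). \<Sum>A\<in>Pow (E Q). w (card A)) =
    (\<Sum>Q\<in>CT U (q, p). \<Sum>A\<in>Pow (E Q). w (card A))"
proof -
  \<comment> \<open>The restriction of \<sigma> to \<open>U\<close>, pulled back along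
    \<open>Inl\<close>.\<close>
  define \<tau> where "\<tau> = {(u, v). u \<in> U \<and> v \<in> U \<and> (Inl u, Inl v) \<in> \<sigma>}"
  define EH where "EH = {e \<in> edges H. edge_within \<sigma> (ends H e)}"
  \<comment> \<open>An initial segment of the naturals stands in for the available edges, as only
    their number matters.\<close>
  define F where "F n = (\<Sum>A\<in>Pow {..<card EH + n}. w (card A))" for n
  have \<tau>: "equiv U \<tau>"
    using assms(5,6) unfolding \<tau>_def
    by (intro equivI refl_onI symI transI) (auto elim!: equivE dest: refl_onD symD transD)
  have inner: "(\<Sum>A\<in>Pow (E Q). w (card A)) = F (card (class_inversions U \<tau> (tier_set 1 Q)))"
    if Q: "Q \<in> CT U (r, s)" for Q r s
  proof -
    have fin: "finite (edges (graph_union H Q))"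
      using finite_graph_union[OF assms(4,5) CT_D(1,2)[OF Q]] by (simp add: finite_graph_def)
    have "edge_within \<sigma> (map_uprod Inl e) \<longleftrightarrow> edge_within \<tau> e" if e: "e \<in> tedges Q" for e
    proof -
      obtain u v where "e = Upair u v" "u \<in> U" "v \<in> U"
        using e CT_D(3,4)[OF Q] by blast
      then show ?thesis by (auto simp: edge_within_def \<tau>_def)
    qed
    then have "E Q = EH <+> {e \<in> tedges Q. edge_within \<tau> e}"
      by (auto simp: E_def EH_def graph_union_def)
    moreover have "finite (E Q)" using fin by (simp add: E_def)
    ultimately have "card (E Q) = card EH + card (class_inversions U \<tau> (tier_set 1 Q))"
      by (simp add: card_Plus card_tedges_within[OF Q \<tau>])
    then show ?thesis
      unfolding F_def using \<open>finite (E Q)\<close> by (intro sum_Pow_card_cong) auto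
  qed
  have outer: "(\<Sum>Q\<in>CT U (r, s). \<Sum>A\<in>Pow (E Q). w (card A)) =
      (\<Sum>S | S \<subseteq> U \<and> card S = r. F (card (class_inversions U \<tau> S)))" if "r + s = card U" for r s
    using inner sum.reindex_bij_betw[OF bij_betw_CT[OF assms(1,2) that]] by simp
  show ?thesis
    using outer[OF assms(3)] outer[of q p] assms(3)
      sum_class_inversions_symmetric[OF assms(1) \<tau> assms(3), of F] by (simp add: add.commute)
qed

theorem theorem1p3:
  fixes U :: "nat set" and p\<^sub>1 p\<^sub>2 :: nat and H :: "(nat + 'a, 'e) mgraph"
  assumes "finite U" and "U \<noteq> {}" and "\<forall>u\<in>U. 0 < u"
    and "0 < p\<^sub>1" and "0 < p\<^sub>2" and "p\<^sub>1 + p\<^sub>2 = card U"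
    and "finite_graph H" and "Inl ` U \<subseteq> verts H"
  shows "(\<Sum>Q | Q \<in> CT U (p\<^sub>1, p\<^sub>2) \<and> connected_graph (graph_union H Q).
            poly (tutte (graph_union H Q)) 1) =
         (\<Sum>Q | Q \<in> CT U (p\<^sub>2, p\<^sub>1) \<and> connected_graph (graph_union H Q).
            poly (tutte (graph_union H Q)) 1)"
proof -
  define V where "V = verts H"
  \<comment> \<open>Attached to every edge set, even where the exponent is truncated to 0: the
    comparison below any \<sigma> holds for all weights that depend on the size only.\<close>
  define w where "w n = ([:0, 1:] - 1 :: int poly) ^ (Suc n - card V)" for n
  define X where "X p = (SIGMA Q:CT U p. Pow (edges (graph_union H Q)))" for p
  define f where "f = (\<lambda>(Q, A). reach_rel (graph_union H Q) A)"
  define w' where "w' = (\<lambda>(Q :: tgraph, A :: ('e + nat uprod) set). w (card A))"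
  have V: "finite V" "V \<noteq> {}" and verts: "verts (graph_union H Q) = V" for Q
    using assms(2,7,8) by (auto simp: V_def finite_graph_def graph_union_def)
  have fin_Q: "finite_graph (graph_union H Q)" if "Q \<in> CT U (p, q)" for Q p q
    using finite_graph_union[OF assms(7,8) CT_D(1,2)[OF that]] .
  have fin_E: "finite (edges (graph_union H Q))" if "Q \<in> CT U (p, q)" for Q p q
    using fin_Q[OF that] by (simp add: finite_graph_def)
  have fin_CT: "finite (CT U (p, q))" if "p + q = card U" for p q
    using finite_CT[OF assms(1,3) that] .
  have fin_X: "finite (X (p, q))" if "p + q = card U" for p q
    unfolding X_def using fin_CT[OF that] fin_E by blast
  \<comment> \<open>Used with \<open>P\<close> as equality to \<open>V \<times> V\<close> for the
    two sides of the theorem, and as containment in \<sigma> for the inversion.\<close>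
  have Sigma: "(\<Sum>x | x \<in> X (p, q) \<and> P (f x). w' x) =
      (\<Sum>Q\<in>CT U (p, q). \<Sum>A | A \<subseteq> edges (graph_union H Q) \<and> P (reach_rel (graph_union H Q) A).
        w (card A))" if "p + q = card U" for p q P
  proof -
    have "{x. x \<in> X (p, q) \<and> P (f x)} =
        (SIGMA Q:CT U (p, q). {A. A \<subseteq> edges (graph_union H Q) \<and> P (reach_rel (graph_union H Q) A)})"
      by (auto simp: X_def f_def)
    then show ?thesis
      using fin_CT[OF that] fin_E by (simp add: sum.Sigma w'_def)
  qed
  have lhs: "(\<Sum>Q | Q \<in> CT U (p, q) \<and> connected_graph (graph_union H Q).
      poly (tutte (graph_union H Q)) 1) = (\<Sum>x | x \<in> X (p, q) \<and> f x = V \<times> V. w' x)"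
    if pq: "p + q = card U" for p q
  proof -
    have empty: "{A. A \<subseteq> edges (graph_union H Q) \<and> reach_rel (graph_union H Q) A = V \<times> V} = {}"
      if "\<not> connected_graph (graph_union H Q)" for Q
    proof -
      have "reach_rel (graph_union H Q) A \<subseteq> reach_rel (graph_union H Q) (edges (graph_union H Q))"
        if "A \<subseteq> edges (graph_union H Q)" for A
        using reach_by_mono[OF that, of "graph_union H Q"] by (auto simp: reach_rel_def)
      moreover have "reach_rel (graph_union H Q) (edges (graph_union H Q)) \<subset> V \<times> V"
        using that V(2) verts[of Q] by (auto simp: connected_graph_iff reach_rel_def)
      ultimately show ?thesis by blast
    qed
    have "(\<Sum>Q | Q \<in> CT U (p, q) \<and> connected_graph (graph_union H Q).
        poly (tutte (graph_union H Q)) 1) =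
      (\<Sum>Q | Q \<in> CT U (p, q) \<and> connected_graph (graph_union H Q).
        \<Sum>A | A \<subseteq> edges (graph_union H Q) \<and> reach_rel (graph_union H Q) A = V \<times> V. w (card A))"
      using fin_Q by (intro sum.cong) (auto simp: poly_tutte_1_connected verts w_def)
    also have "\<dots> = (\<Sum>Q\<in>CT U (p, q).
        \<Sum>A | A \<subseteq> edges (graph_union H Q) \<and> reach_rel (graph_union H Q) A = V \<times> V. w (card A))"
      using fin_CT[OF pq] by (intro sum.mono_neutral_left ballI) (auto simp: empty)
    finally show ?thesis by (simp only: Sigma[OF pq, of "\<lambda>\<rho>. \<rho> = V \<times> V"])
  qed
  have below: "(\<Sum>x | x \<in> X (p\<^sub>1, p\<^sub>2) \<and> f x \<subseteq> \<sigma>. w' x) = (\<Sum>x | x \<in> X (p\<^sub>2, p\<^sub>1) \<and> f x \<subseteq> \<sigma>. w' x)"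
    if \<sigma>: "\<sigma> \<in> Collect (equiv V)" for \<sigma>
  proof -
    let ?E = "\<lambda>Q. {e \<in> edges (graph_union H Q). edge_within \<sigma> (ends (graph_union H Q) e)}"
    have "{A. A \<subseteq> edges (graph_union H Q) \<and> reach_rel (graph_union H Q) A \<subseteq> \<sigma>} = Pow (?E Q)"
      if "Q \<in> CT U (p, q)" for Q p q
      using reach_rel_subset_iff[OF fin_Q[OF that]] \<sigma> verts[of Q] by auto
    then have "(\<Sum>x | x \<in> X (p, q) \<and> f x \<subseteq> \<sigma>. w' x) =
        (\<Sum>Q\<in>CT U (p, q). \<Sum>A\<in>Pow (?E Q). w (card A))" if "p + q = card U" for p q
      using Sigma[OF that, of "\<lambda>\<rho>. \<rho> \<subseteq> \<sigma>"] by simp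
    moreover have "p\<^sub>2 + p\<^sub>1 = card U" using assms(6) by simp
    ultimately show ?thesis
      using sum_within_symmetric[OF assms(1,3,6,7,8), of \<sigma> w] \<sigma> assms(6) by (simp add: V_def)
  qed
  have img: "f ` X p \<subseteq> Collect (equiv V)" for p
    using equiv_reach_rel verts by (force simp: f_def)
  have swap: "p\<^sub>2 + p\<^sub>1 = card U" using assms(6) by simp
  \<comment> \<open>The fibre over the largest equivalence relation collects the connected spanning
    edge sets.\<close>
  have "equiv V (V \<times> V)" by (auto intro!: equivI refl_onI symI transI)
  then show ?thesis
    using sum_fibres_eq_if_sums_below_eq[OF fin_X[OF assms(6)] fin_X[OF swap] img img below]
      V(1) lhs[OF assms(6)] lhs[OF swap] by simp
qed

end
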